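(* Let $\mathcal{A}$ be a Banach algebra which has a bounded two-sided approximate identity and let $\mathcal{I}$ be a closed left ideal in $\mathcal{A}$ which is amenable and has a bounded left approximate identity for $\mathcal{A}$, that is, there is a norm-bounded net $(e_\lambda)$ in $\mathcal{I}$ with $e_\lambda a\to a$ for all $a\in\mathcal{A}$. Then $\mathcal{A}$ is amenable.
   Context: A Banach algebra $\mathcal{A}$ is amenable if for every Banach $\mathcal{A}$-bimodule $Z$, every continuous derivation $D:\mathcal{A}\to Z^*$ is inner, i.e. of the form $a\mapsto a\cdot z^*-z^*\cdot a$ for some $z^*\in Z^*$. Here $Z^*$ carries the dual module actions $\langle a\cdot z^*,z\rangle=\langle z^*,z\cdot a\rangle$, $\langle z^*\cdot a,z\rangle=\langle z^*,a\cdot z\rangle$, and a derivation is a linear map with $D(ab)=a\cdot D(b)+D(a)\cdot b$. A bounded two-sided approximate identity of $\mathcal{A}$ is a norm-bounded net $(f_\beta)$ in $\mathcal{A}$ with $f_\beta a\to a$ and $af_\beta\to a$ for all $a\in\mathcal{A}$. *)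

theory Defs
  imports "HOL-Analysis.Analysis"
begin

text \<open>
  The scalars are a type \<open>'k\<close> of sort \<open>{real_normed_field, heine_borel}\<close>. By the
  Gelfand--Mazur theorem such a field is isometrically isomorphic to the reals or to the complex
  numbers, so real and complex Banach algebras are treated together. As the library class of
  Banach spaces only knows real scalars, multiplication by \<open>'k\<close> is a separate function
  extending \<^const>\<open>scaleR\<close>. Algebras need not have a unit.
\<close>

locale banach_algebra = vector_space scl
  for scl :: "'k::{real_normed_field, heine_borel} \<Rightarrow> 'a::{real_normed_algebra, banach} \<Rightarrow> 'a" +
  assumes scale_of_real: "scl (of_real r) x = r *\<^sub>R x"
    and norm_scale: "norm (scl c x) = norm c * norm x"
    and mult_scale_left: "scl c x * y = scl c (x * y)"
    and mult_scale_right: "x * scl c y = scl c (x * y)"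

definition closed_left_ideal ::
    "('k::{real_normed_field, heine_borel} \<Rightarrow> 'a::{real_normed_algebra, banach} \<Rightarrow> 'a) \<Rightarrow> 'a set \<Rightarrow> bool"
  where "closed_left_ideal scl I \<longleftrightarrow>
    module.subspace scl I \<and> closed I \<and> (\<forall>a. \<forall>x\<in>I. a * x \<in> I)"

text \<open>
  A net is a function on a type \<open>'i\<close> together with a proper filter on \<open>'i\<close>; for a directed
  index set this is the filter generated by the tails \<open>{j. i \<le> j}\<close>.
\<close>

definition bounded_left_approx_identity ::
    "('i \<Rightarrow> 'a::{real_normed_algebra, banach}) \<Rightarrow> 'i filter \<Rightarrow> bool"
  where "bounded_left_approx_identity e F \<longleftrightarrow>
    F \<noteq> bot \<and> bounded (range e) \<and> (\<forall>a. ((\<lambda>i. e i * a) \<longlongrightarrow> a) F)"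

definition bounded_approx_identity ::
    "('i \<Rightarrow> 'a::{real_normed_algebra, banach}) \<Rightarrow> 'i filter \<Rightarrow> bool"
  where "bounded_approx_identity e F \<longleftrightarrow>
    F \<noteq> bot \<and> bounded (range e) \<and>
    (\<forall>a. ((\<lambda>i. e i * a) \<longlongrightarrow> a) F \<and> ((\<lambda>i. a * e i) \<longlongrightarrow> a) F)"

text \<open>
  Amenability quantifies over all Banach bimodules, which is impossible for instances of a type
  class. Normed spaces and bimodules are therefore records with an explicit carrier set inside a
  type \<open>'z\<close>; the operations are only relevant on the carrier.
\<close>

record ('k, 'z) nspace =
  vcarrier :: "'z set"
  vadd :: "'z \<Rightarrow> 'z \<Rightarrow> 'z"
  vzero :: 'z
  vscale :: "'k \<Rightarrow> 'z \<Rightarrow> 'z"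
  vnorm :: "'z \<Rightarrow> real"

record ('a, 'k, 'z) bimod = "('k, 'z) nspace" +
  lact :: "'a \<Rightarrow> 'z \<Rightarrow> 'z"
  ract :: "'z \<Rightarrow> 'a \<Rightarrow> 'z"

definition vdiff :: "('k::real_normed_field, 'z, 'm) nspace_scheme \<Rightarrow> 'z \<Rightarrow> 'z \<Rightarrow> 'z"
  where "vdiff Z x y = vadd Z x (vscale Z (- 1) y)"

definition vdist :: "('k::real_normed_field, 'z, 'm) nspace_scheme \<Rightarrow> 'z \<Rightarrow> 'z \<Rightarrow> real"
  where "vdist Z x y = vnorm Z (vdiff Z x y)"

locale normed_vspace =
  fixes Z :: "('k::real_normed_field, 'z, 'm) nspace_scheme"
  assumes add_closed: "\<lbrakk>x \<in> vcarrier Z; y \<in> vcarrier Z\<rbrakk> \<Longrightarrow> vadd Z x y \<in> vcarrier Z"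
    and zero_closed: "vzero Z \<in> vcarrier Z"
    and scale_closed: "x \<in> vcarrier Z \<Longrightarrow> vscale Z c x \<in> vcarrier Z"
    and add_assoc: "\<lbrakk>x \<in> vcarrier Z; y \<in> vcarrier Z; z \<in> vcarrier Z\<rbrakk> \<Longrightarrow>
      vadd Z (vadd Z x y) z = vadd Z x (vadd Z y z)"
    and add_commute: "\<lbrakk>x \<in> vcarrier Z; y \<in> vcarrier Z\<rbrakk> \<Longrightarrow> vadd Z x y = vadd Z y x"
    and add_zero: "x \<in> vcarrier Z \<Longrightarrow> vadd Z x (vzero Z) = x"
    and add_inverse: "x \<in> vcarrier Z \<Longrightarrow> vadd Z x (vscale Z (- 1) x) = vzero Z"
    and scale_add_right: "\<lbrakk>x \<in> vcarrier Z; y \<in> vcarrier Z\<rbrakk> \<Longrightarrow>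
      vscale Z c (vadd Z x y) = vadd Z (vscale Z c x) (vscale Z c y)"
    and scale_add_left: "x \<in> vcarrier Z \<Longrightarrow>
      vscale Z (c + d) x = vadd Z (vscale Z c x) (vscale Z d x)"
    and scale_scale: "x \<in> vcarrier Z \<Longrightarrow> vscale Z c (vscale Z d x) = vscale Z (c * d) x"
    and scale_one: "x \<in> vcarrier Z \<Longrightarrow> vscale Z 1 x = x"
    and norm_nonneg: "x \<in> vcarrier Z \<Longrightarrow> 0 \<le> vnorm Z x"
    and norm_eq_zero: "x \<in> vcarrier Z \<Longrightarrow> vnorm Z x = 0 \<longleftrightarrow> x = vzero Z"
    and norm_triangle: "\<lbrakk>x \<in> vcarrier Z; y \<in> vcarrier Z\<rbrakk> \<Longrightarrow>
      vnorm Z (vadd Z x y) \<le> vnorm Z x + vnorm Z y"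
    and norm_vscale: "x \<in> vcarrier Z \<Longrightarrow> vnorm Z (vscale Z c x) = norm c * vnorm Z x"

locale banach_vspace = normed_vspace +
  assumes complete: "Metric_space.mcomplete (vcarrier Z) (vdist Z)"

text \<open>
  In the following, \<open>S\<close> is a closed subalgebra of the ambient algebra \<open>'a\<close>, itself regarded as a
  Banach algebra; only the actions of elements of \<open>S\<close> matter.
\<close>

locale banach_bimodule = banach_vspace Z
  for scl :: "'k::{real_normed_field, heine_borel} \<Rightarrow> 'a::{real_normed_algebra, banach} \<Rightarrow> 'a"
    and S :: "'a set"
    and Z :: "('a, 'k, 'z, 'm) bimod_scheme" +
  assumes lact_closed: "\<lbrakk>a \<in> S; z \<in> vcarrier Z\<rbrakk> \<Longrightarrow> lact Z a z \<in> vcarrier Z"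
    and ract_closed: "\<lbrakk>a \<in> S; z \<in> vcarrier Z\<rbrakk> \<Longrightarrow> ract Z z a \<in> vcarrier Z"
    and lact_add_left: "\<lbrakk>a \<in> S; b \<in> S; z \<in> vcarrier Z\<rbrakk> \<Longrightarrow>
      lact Z (a + b) z = vadd Z (lact Z a z) (lact Z b z)"
    and lact_scale_left: "\<lbrakk>a \<in> S; z \<in> vcarrier Z\<rbrakk> \<Longrightarrow>
      lact Z (scl c a) z = vscale Z c (lact Z a z)"
    and lact_add_right: "\<lbrakk>a \<in> S; y \<in> vcarrier Z; z \<in> vcarrier Z\<rbrakk> \<Longrightarrow>
      lact Z a (vadd Z y z) = vadd Z (lact Z a y) (lact Z a z)"
    and lact_scale_right: "\<lbrakk>a \<in> S; z \<in> vcarrier Z\<rbrakk> \<Longrightarrow>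
      lact Z a (vscale Z c z) = vscale Z c (lact Z a z)"
    and ract_add_left: "\<lbrakk>a \<in> S; y \<in> vcarrier Z; z \<in> vcarrier Z\<rbrakk> \<Longrightarrow>
      ract Z (vadd Z y z) a = vadd Z (ract Z y a) (ract Z z a)"
    and ract_scale_left: "\<lbrakk>a \<in> S; z \<in> vcarrier Z\<rbrakk> \<Longrightarrow>
      ract Z (vscale Z c z) a = vscale Z c (ract Z z a)"
    and ract_add_right: "\<lbrakk>a \<in> S; b \<in> S; z \<in> vcarrier Z\<rbrakk> \<Longrightarrow>
      ract Z z (a + b) = vadd Z (ract Z z a) (ract Z z b)"
    and ract_scale_right: "\<lbrakk>a \<in> S; z \<in> vcarrier Z\<rbrakk> \<Longrightarrow>
      ract Z z (scl c a) = vscale Z c (ract Z z a)"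
    and lact_mult: "\<lbrakk>a \<in> S; b \<in> S; z \<in> vcarrier Z\<rbrakk> \<Longrightarrow> lact Z (a * b) z = lact Z a (lact Z b z)"
    and ract_mult: "\<lbrakk>a \<in> S; b \<in> S; z \<in> vcarrier Z\<rbrakk> \<Longrightarrow> ract Z z (a * b) = ract Z (ract Z z a) b"
    and lact_ract: "\<lbrakk>a \<in> S; b \<in> S; z \<in> vcarrier Z\<rbrakk> \<Longrightarrow>
      ract Z (lact Z a z) b = lact Z a (ract Z z b)"
    and lact_bounded: "\<exists>K. \<forall>a\<in>S. \<forall>z\<in>vcarrier Z. vnorm Z (lact Z a z) \<le> K * norm a * vnorm Z z"
    and ract_bounded: "\<exists>K. \<forall>a\<in>S. \<forall>z\<in>vcarrier Z. vnorm Z (ract Z z a) \<le> K * norm a * vnorm Z z"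

text \<open>
  Functionals are taken to be \<^const>\<open>undefined\<close> off the carrier of \<open>Z\<close>, so that elements of the
  dual are equal as soon as they agree on the carrier.
\<close>

definition bounded_functionals :: "('k::real_normed_field, 'z, 'm) nspace_scheme \<Rightarrow> ('z \<Rightarrow> 'k) set"
  where "bounded_functionals Z =
    {f \<in> extensional (vcarrier Z).
      (\<forall>x\<in>vcarrier Z. \<forall>y\<in>vcarrier Z. f (vadd Z x y) = f x + f y) \<and>
      (\<forall>c. \<forall>x\<in>vcarrier Z. f (vscale Z c x) = c * f x) \<and>
      (\<exists>K. \<forall>x\<in>vcarrier Z. norm (f x) \<le> K * vnorm Z x)}"

definition dual_bimodule :: "('a, 'k::real_normed_field, 'z, 'm) bimod_scheme \<Rightarrow> ('a, 'k, 'z \<Rightarrow> 'k) bimod"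
  where "dual_bimodule Z =
    \<lparr>vcarrier = bounded_functionals Z,
     vadd = (\<lambda>f g. \<lambda>z\<in>vcarrier Z. f z + g z),
     vzero = (\<lambda>z\<in>vcarrier Z. 0),
     vscale = (\<lambda>c f. \<lambda>z\<in>vcarrier Z. c * f z),
     vnorm = (\<lambda>f. SUP z\<in>{z \<in> vcarrier Z. vnorm Z z \<le> 1}. norm (f z)),
     lact = (\<lambda>a f. \<lambda>z\<in>vcarrier Z. f (ract Z z a)),
     ract = (\<lambda>f a. \<lambda>z\<in>vcarrier Z. f (lact Z a z))\<rparr>"

definition continuous_derivation ::
    "('k::{real_normed_field, heine_borel} \<Rightarrow> 'a::{real_normed_algebra, banach} \<Rightarrow> 'a) \<Rightarrow> 'a set \<Rightarrow>
      ('a, 'k, 'x, 'm) bimod_scheme \<Rightarrow> ('a \<Rightarrow> 'x) \<Rightarrow> bool"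
  where "continuous_derivation scl S X D \<longleftrightarrow>
    (\<forall>a\<in>S. D a \<in> vcarrier X) \<and>
    (\<forall>a\<in>S. \<forall>b\<in>S. D (a + b) = vadd X (D a) (D b)) \<and>
    (\<forall>c. \<forall>a\<in>S. D (scl c a) = vscale X c (D a)) \<and>
    (\<forall>a\<in>S. \<forall>b\<in>S. D (a * b) = vadd X (lact X a (D b)) (ract X (D a) b)) \<and>
    continuous_map (top_of_set S) (Metric_space.mtopology (vcarrier X) (vdist X)) D"

definition inner_derivation ::
    "'a set \<Rightarrow> ('a, 'k::real_normed_field, 'x, 'm) bimod_scheme \<Rightarrow> ('a \<Rightarrow> 'x) \<Rightarrow> bool"
  where "inner_derivation S X D \<longleftrightarrow>
    (\<exists>x\<in>vcarrier X. \<forall>a\<in>S. D a = vdiff X (lact X a x) (ract X x a))"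

text \<open>
  The type argument is the universe of the bimodules: \<open>Z\<close> ranges over all Banach \<open>S\<close>-bimodules
  whose underlying set is a set of elements of type \<open>'z\<close>. Amenability in the usual sense is amenability for
  every \<open>'z\<close>.
\<close>

definition amenable ::
    "'z itself \<Rightarrow>
      ('k::{real_normed_field, heine_borel} \<Rightarrow> 'a::{real_normed_algebra, banach} \<Rightarrow> 'a) \<Rightarrow>
      'a set \<Rightarrow> bool"
  where "amenable (_ :: 'z itself) scl S \<longleftrightarrow>
    (\<forall>Z :: ('a, 'k, 'z) bimod. banach_bimodule scl S Z \<longrightarrow>
      (\<forall>D. continuous_derivation scl S (dual_bimodule Z) D \<longrightarrow>
        inner_derivation S (dual_bimodule Z) D))"

end

theory Submission
  imports Defs
begin

text \<open>
  Let \<open>D\<close> be a continuous derivation from the algebra into the dual of a Banach bimodule \<open>Z\<close>. The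
  same \<open>Z\<close> is a Banach bimodule over the ideal \<open>I\<close>, so amenability of \<open>I\<close> yields a functional \<open>\<xi>\<close>
  such that the derivation \<open>T a = D a - (a \<cdot> \<xi> - \<xi> \<cdot> a)\<close> vanishes on \<open>I\<close>. For \<open>x \<in> I\<close> also
  \<open>a x \<in> I\<close>, and the product rule for \<open>T (a x)\<close> becomes \<open>T a \<cdot> x = 0\<close>. With \<open>x = e\<^sub>j\<close> the functional
  \<open>T a\<close> annihilates \<open>e\<^sub>j \<cdot> (b \<cdot> z)\<close>, and as it is continuous and \<open>e\<^sub>j b \<longlongrightarrow> b\<close>, it annihilates
  \<open>b \<cdot> z\<close>. So \<open>T a \<cdot> b = 0\<close> for all \<open>a\<close> and \<open>b\<close> of the algebra. Hence the product rule shrinks to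
  \<open>T (a b) = a \<cdot> T b\<close>, that is, \<open>T\<close> is a homomorphism of left modules.

  Such a homomorphism is an orbit map \<open>T a = a \<cdot> \<phi>\<close>: for a bounded approximate identity \<open>f\<close>, take
  \<open>\<phi>\<close> to be a weak* cluster point of the net \<open>T (f i)\<close> and compare \<open>a \<cdot> T (f i) = T (a f i)\<close> with
  \<open>T a\<close> (\<open>left_module_map_into_dual_eq_orbit_map\<close>). As \<open>T (f i) \<cdot> a = 0\<close>, also \<open>\<phi> \<cdot> a = 0\<close>, so that
  \<open>T a = a \<cdot> \<phi> - \<phi> \<cdot> a\<close> and \<open>D\<close> is the inner derivation of \<open>\<xi> + \<phi>\<close>. Only the
  bimodule \<open>Z\<close> itself occurs, so the universe of bimodules is the same for \<open>I\<close> and the algebra.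

  The passage to the limit needs a uniform bound on \<open>T\<close>. It is automatic for homomorphisms of left
  modules: \<open>T (b c) = b \<cdot> T c\<close> is bounded in \<open>b\<close> for fixed \<open>c\<close>, and by Cohen's factorization theorem
  (\<open>Cohen_factorization_uniform\<close>) all terms of a null sequence have a common right factor \<open>c\<close> with
  bounded left factors, so \<open>T\<close> cannot blow up along a null sequence
  (\<open>uniform_bound_from_right_multiples\<close>).
\<close>

section \<open>Cohen factorization\<close>

lemma convergent_geometric_increments:
  fixes s :: "nat \<Rightarrow> 'b::banach"
  assumes "\<And>n. norm (s (Suc n) - s n) \<le> r ^ n" "0 \<le> r" "r < 1"
  shows "convergent s"
proof -
  have "summable (\<lambda>n. r ^ n)"
    using assms by (intro summable_geometric) simp
  then have "summable (\<lambda>n. s (Suc n) - s n)"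
    by (rule summable_comparison_test'[where N = 0]) (use assms in auto)
  then have "convergent (\<lambda>n. \<Sum>k<n. s (Suc k) - s k)"
    by (simp add: summable_iff_convergent)
  then have "convergent (\<lambda>n. s n - s 0)"
    by (simp add: sum_lessThan_telescope)
  then show ?thesis
    using convergent_add[OF _ convergent_const[of "s 0"], of "\<lambda>n. s n - s 0"] by simp
qed

text \<open>
  One step of the factorization inverts right multiplication by \<open>1 - \<gamma> + \<gamma> u\<close>, an element of the
  unitization. Working with the operator \<open>y \<mapsto> (1 - \<gamma>) y + \<gamma> y u\<close> instead avoids adjoining a unit; it
  is invertible because \<open>\<gamma>\<close> is small relative to the bound on \<open>u\<close>. When \<open>w u\<close> is close to \<open>w\<close>, the
  operator hardly moves \<open>w\<close>, so neither does its inverse.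
\<close>

lemma solve_right_mult_near_identity:
  fixes u w :: "'a::{real_normed_algebra, banach}"
  assumes "norm u \<le> M" "0 < \<gamma>" "\<gamma> \<le> 1/4" "\<gamma> * M \<le> 1/4"
  obtains y where "w = (1 - \<gamma>) *\<^sub>R y + \<gamma> *\<^sub>R (y * u)" "norm (y - w) \<le> norm (w * u - w)"
proof -
  have mult_u: "\<gamma> * norm (y * u) \<le> norm y / 4" for y
  proof -
    have "\<gamma> * norm (y * u) \<le> \<gamma> * (norm y * M)"
      using assms by (meson less_imp_le mult_left_mono norm_ge_zero norm_mult_ineq order_trans)
    also have "\<dots> = norm y * (\<gamma> * M)" by simp
    also have "\<dots> \<le> norm y * (1/4)"
      using assms by (intro mult_left_mono) auto
    finally show ?thesis by simp
  qed
  \<comment> \<open>The equation for \<open>y\<close> is the fixed point equation of a contraction with ratio 1/3.\<close>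
  define h where "h y = (1 / (1 - \<gamma>)) *\<^sub>R (w - \<gamma> *\<^sub>R (y * u))" for y
  have "dist (h y) (h y') \<le> (1/3) * dist y y'" for y y'
  proof -
    have "h y - h y' = (1 / (1 - \<gamma>)) *\<^sub>R (\<gamma> *\<^sub>R ((y' - y) * u))"
      by (simp add: h_def algebra_simps)
    then have "norm (h y - h y') = (1 / (1 - \<gamma>)) * (\<gamma> * norm ((y' - y) * u))"
      using assms by simp
    also have "\<dots> \<le> (4/3) * (norm (y' - y) / 4)"
      using assms mult_u[of "y' - y"] by (intro mult_mono) (auto simp: divide_le_eq)
    finally show ?thesis
      by (simp add: dist_norm norm_minus_commute)
  qed
  then have "\<exists>!y. h y = y"
    by (intro banach_fix_type[of "1/3"]) auto
  then obtain y where y: "h y = y" by blast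
  have "(1 - \<gamma>) *\<^sub>R y = w - \<gamma> *\<^sub>R (y * u)"
    using assms by (subst y[symmetric]) (simp add: h_def)
  then have w: "w = (1 - \<gamma>) *\<^sub>R y + \<gamma> *\<^sub>R (y * u)"
    by (simp add: algebra_simps)
  define d where "d = y - w"
  have "y = w + d" by (simp add: d_def)
  with w have "(1 - \<gamma>) *\<^sub>R d + \<gamma> *\<^sub>R (d * u) = - (\<gamma> *\<^sub>R (w * u - w))"
    by (simp add: algebra_simps)
  then have "(1 - \<gamma>) *\<^sub>R d = - (\<gamma> *\<^sub>R (w * u - w)) - \<gamma> *\<^sub>R (d * u)"
    by (simp add: eq_diff_eq)
  then have "norm ((1 - \<gamma>) *\<^sub>R d) \<le> norm (\<gamma> *\<^sub>R (w * u - w)) + norm (\<gamma> *\<^sub>R (d * u))"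
    by (metis norm_minus_cancel norm_triangle_ineq4)
  then have "(1 - \<gamma>) * norm d \<le> \<gamma> * norm (w * u - w) + norm d / 4"
    using assms mult_u[of d] by simp
  moreover have "3/4 * norm d \<le> (1 - \<gamma>) * norm d" "\<gamma> * norm (w * u - w) \<le> 1/4 * norm (w * u - w)"
    using assms by (intro mult_right_mono; simp)+
  ultimately have "norm d \<le> norm (w * u - w)"
    using norm_ge_zero[of "w * u - w"] by linarith
  with w show thesis
    using that d_def by simp
qed

text \<open>
  Let \<open>\<delta> = 1 - \<gamma>\<close>. In the unitization put \<open>U\<^sub>k = \<delta> + \<gamma> u\<^sub>k\<close> with \<open>u\<^sub>k\<close> chosen from the approximate
  identity, and write \<open>x = g\<^sub>n x \<cdot> C\<^sub>n\<close> with \<open>C\<^sub>n = U\<^sub>n \<cdots> U\<^sub>1\<close>. The left factors \<open>g\<^sub>n x\<close> converge if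
  \<open>u\<^sub>n\<^sub>+\<^sub>1\<close> almost fixes them from the right. The scalar part of \<open>C\<^sub>n\<close> is \<open>\<delta>\<^sup>n\<close>, which tends to 0, and
  its part \<open>a\<^sub>n\<close> in the algebra converges if \<open>u\<^sub>n\<^sub>+\<^sub>1\<close> almost fixes \<open>a\<^sub>n\<close> from the left. So
  \<open>c = lim a\<^sub>n\<close> is a right factor inside the algebra. Because the approximate identity is two-sided,
  one \<open>u\<^sub>n\<^sub>+\<^sub>1\<close> can serve both purposes, and the multiplicative form of \<open>C\<^sub>n\<close> makes the factorization
  exact at every stage. All choices are uniform over \<open>X\<close>, so the right factor is common to all of \<open>X\<close>.
\<close>

theorem Cohen_factorization_uniform:
  fixes f :: "'i \<Rightarrow> 'a::{real_normed_algebra, banach}"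
  assumes bai: "bounded_approx_identity f F"
    and bdd: "bounded X"
    and unif: "uniform_limit X (\<lambda>i x. x * f i) (\<lambda>x. x) F"
  obtains c g where "\<And>x. x \<in> X \<Longrightarrow> x = g x * c" "\<And>x. x \<in> X \<Longrightarrow> norm (g x - x) \<le> 1"
proof -
  obtain M where M: "M \<ge> 1" "\<And>i. norm (f i) \<le> M"
  proof -
    obtain B where "\<And>i. norm (f i) \<le> B"
      using bai unfolding bounded_approx_identity_def bounded_iff by auto
    then show ?thesis
      using that[of "max 1 B"] by (simp add: max.coboundedI2)
  qed
  define \<gamma> where "\<gamma> = 1 / (4 * M)"
  define \<delta> where "\<delta> = 1 - \<gamma>"
  have \<gamma>: "0 < \<gamma>" "\<gamma> \<le> 1/4" "\<gamma> * M = 1/4" and \<delta>: "3/4 \<le> \<delta>" "\<delta> < 1"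
    using M(1) by (auto simp: \<gamma>_def \<delta>_def field_simps)
  \<comment> \<open>A state is the pair of the algebra part \<open>a\<^sub>n\<close> of \<open>C\<^sub>n\<close> and the map \<open>g\<^sub>n\<close>. The uniform limit
    must be carried along, since it is what allows the next choice from the approximate identity.\<close>
  define P where "P n s \<longleftrightarrow>
      (\<forall>x\<in>X. x = \<delta> ^ n *\<^sub>R snd s x + snd s x * fst s) \<and>
      uniform_limit X (\<lambda>i x. snd s x * f i) (snd s) F \<and> bounded (snd s ` X)"
    for n and s :: "'a \<times> ('a \<Rightarrow> 'a)"
  define Q where "Q n s s' \<longleftrightarrow> norm (fst s' - fst s) \<le> \<delta> ^ n \<and>
      (\<forall>x\<in>X. norm (snd s' x - snd s x) \<le> (1/2) ^ Suc n)"
    for n and s s' :: "'a \<times> ('a \<Rightarrow> 'a)"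
  have start: "P 0 (0, \<lambda>x. x)"
    using unif bdd by (simp add: P_def)
  have step: "\<exists>s'. P (Suc n) s' \<and> Q n s s'" if P: "P n s" for n s
  proof -
    obtain a g where s: "s = (a, g)" by (cases s)
    have eq: "\<And>x. x \<in> X \<Longrightarrow> x = \<delta> ^ n *\<^sub>R g x + g x * a"
      and ul: "uniform_limit X (\<lambda>i x. g x * f i) g F" and bg: "bounded (g ` X)"
      using P by (auto simp: P_def s)
    have half: "(0::real) < (1/2) ^ Suc n" by simp
    have "((\<lambda>i. f i * a) \<longlongrightarrow> a) F"
      using bai by (simp add: bounded_approx_identity_def)
    then have "eventually (\<lambda>i. dist (f i * a) a < (1/2) ^ Suc n) F"
      using half by (rule tendstoD)
    then have "eventually (\<lambda>i. dist (f i * a) a < (1/2) ^ Suc n \<and>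
        (\<forall>x\<in>X. dist (g x * f i) (g x) < (1/2) ^ Suc n)) F"
      using uniform_limitD[OF ul half] by eventually_elim auto
    moreover have "F \<noteq> bot"
      using bai by (simp add: bounded_approx_identity_def)
    ultimately have "\<exists>i. dist (f i * a) a < (1/2) ^ Suc n \<and>
        (\<forall>x\<in>X. dist (g x * f i) (g x) < (1/2) ^ Suc n)"
      by (rule eventually_happens'[rotated])
    then obtain i where i: "norm (f i * a - a) \<le> (1/2) ^ Suc n"
      "\<And>x. x \<in> X \<Longrightarrow> norm (g x * f i - g x) \<le> (1/2) ^ Suc n"
      unfolding dist_norm by (meson less_imp_le)
    define u where "u = f i"
    have "\<exists>y. g x = \<delta> *\<^sub>R y + \<gamma> *\<^sub>R (y * u) \<and> norm (y - g x) \<le> norm (g x * u - g x)" for x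
      unfolding \<delta>_def u_def
      using solve_right_mult_near_identity[OF M(2) \<gamma>(1,2) eq_refl[OF \<gamma>(3)], of "g x"] by metis
    then obtain g' where g': "\<And>x. g x = \<delta> *\<^sub>R g' x + \<gamma> *\<^sub>R (g' x * u)"
      and g'_near: "\<And>x. norm (g' x - g x) \<le> norm (g x * u - g x)"
      by metis
    \<comment> \<open>the algebra part of \<open>(\<delta> + \<gamma> u) (\<delta>\<^sup>n + a)\<close>\<close>
    define a' where "a' = (\<gamma> * \<delta> ^ n) *\<^sub>R u + \<delta> *\<^sub>R a + \<gamma> *\<^sub>R (u * a)"
    have close: "norm (g' x - g x) \<le> (1/2) ^ Suc n" if "x \<in> X" for x
      using g'_near[of x] i(2)[OF that] by (simp add: u_def)
    have "x = \<delta> ^ Suc n *\<^sub>R g' x + g' x * a'" if "x \<in> X" for x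
    proof -
      have "x = \<delta> ^ n *\<^sub>R g x + g x * a" by (rule eq[OF that])
      also have "\<dots> = \<delta> ^ Suc n *\<^sub>R g' x + g' x * a'"
        unfolding g'[of x] a'_def by (simp add: algebra_simps)
      finally show ?thesis .
    qed
    moreover have bg': "bounded (g' ` X)"
    proof -
      obtain B where B: "\<And>x. x \<in> X \<Longrightarrow> norm (g x) \<le> B"
        using bg by (auto simp: bounded_iff)
      have "norm (g' x) \<le> B + 1" if "x \<in> X" for x
      proof -
        have "(1/2::real) ^ Suc n \<le> 1" by (rule power_le_one) auto
        then show ?thesis
          using B[OF that] close[OF that] norm_triangle_sub[of "g' x" "g x"] by linarith
      qed
      then show ?thesis by (auto simp: bounded_iff)
    qed
    moreover have "uniform_limit X (\<lambda>i x. g' x * f i) g' F"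
    proof (rule uniform_limitI)
      fix \<epsilon> :: real assume \<epsilon>: "0 < \<epsilon>"
      obtain B where B: "\<And>x. x \<in> X \<Longrightarrow> norm (g' x) \<le> B" and "B > 0"
        using bg' by (auto simp: bounded_pos)
      have "((\<lambda>j. u * f j) \<longlongrightarrow> u) F"
        using bai by (simp add: bounded_approx_identity_def)
      then have "eventually (\<lambda>j. dist (u * f j) u < \<epsilon> / (4 * B)) F"
        using \<epsilon> \<open>B > 0\<close> by (intro tendstoD) auto
      moreover have "eventually (\<lambda>j. \<forall>x\<in>X. dist (g x * f j) (g x) < \<epsilon> / 4) F"
        using uniform_limitD[OF ul, of "\<epsilon> / 4"] \<epsilon> by simp
      ultimately show "eventually (\<lambda>j. \<forall>x\<in>X. dist (g' x * f j) (g' x) < \<epsilon>) F"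
      proof eventually_elim
        case (elim j)
        show ?case
        proof
          fix x assume x: "x \<in> X"
          have "\<delta> *\<^sub>R (g' x * f j - g' x) = (g x * f j - g x) - \<gamma> *\<^sub>R (g' x * (u * f j - u))"
            unfolding g'[of x] by (simp add: algebra_simps)
          then have "\<delta> * norm (g' x * f j - g' x) =
              norm ((g x * f j - g x) - \<gamma> *\<^sub>R (g' x * (u * f j - u)))"
            using \<delta> by (metis abs_of_nonneg less_eq_real_def norm_scaleR order_trans
                zero_less_divide_iff zero_less_numeral)
          also have "\<dots> \<le> norm (g x * f j - g x) + \<gamma> * norm (g' x * (u * f j - u))"
            using norm_triangle_ineq4[of "g x * f j - g x" "\<gamma> *\<^sub>R (g' x * (u * f j - u))"] \<gamma>
            by simp
          also have "\<dots> \<le> norm (g x * f j - g x) + 1 * (B * norm (u * f j - u))"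
            using \<gamma> B[OF x] \<open>B > 0\<close>
            by (intro add_left_mono mult_mono order_trans[OF norm_mult_ineq]) auto
          also have "\<dots> < \<epsilon> / 4 + \<epsilon> / 4"
            using elim x \<open>B > 0\<close> by (intro add_strict_mono) (auto simp: dist_norm field_simps)
          finally have "\<delta> * norm (g' x * f j - g' x) < \<epsilon> / 2" by simp
          moreover have "3/4 * norm (g' x * f j - g' x) \<le> \<delta> * norm (g' x * f j - g' x)"
            using \<delta> by (intro mult_right_mono) auto
          ultimately show "dist (g' x * f j) (g' x) < \<epsilon>"
            using \<epsilon> by (simp add: dist_norm)
        qed
      qed
    qed
    moreover have "norm (a' - a) \<le> \<delta> ^ n"
    proof -
      have "a' - a = (\<gamma> * \<delta> ^ n) *\<^sub>R u + \<gamma> *\<^sub>R (u * a - a)"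
        by (simp add: a'_def \<delta>_def algebra_simps)
      then have "norm (a' - a) \<le> \<gamma> * \<delta> ^ n * norm u + \<gamma> * norm (u * a - a)"
        using norm_triangle_ineq[of "(\<gamma> * \<delta> ^ n) *\<^sub>R u" "\<gamma> *\<^sub>R (u * a - a)"] \<gamma> \<delta>
        by (simp add: abs_mult)
      also have "\<dots> \<le> \<gamma> * \<delta> ^ n * M + 1 * (1/2) ^ Suc n"
        using i(1) M(2)[of i] \<gamma> \<delta> by (intro add_mono mult_mono) (auto simp: u_def)
      also have "\<gamma> * \<delta> ^ n * M = \<delta> ^ n / 4"
        using \<gamma>(3) by (simp add: mult.commute mult.left_commute)
      also have "1 * (1/2) ^ Suc n \<le> \<delta> ^ n / 2"
        using power_mono[of "1/2" \<delta> n] \<delta> by simp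
      finally show ?thesis
        using \<delta> zero_le_power[of \<delta> n] by linarith
    qed
    ultimately have "P (Suc n) (a', g') \<and> Q n s (a', g')"
      using close by (auto simp: P_def Q_def s)
    then show ?thesis by blast
  qed
  obtain S where S: "\<And>n. P n (S n)" "\<And>n. Q n (S n) (S (Suc n))" and S0: "S 0 = (0, \<lambda>x. x)"
  proof -
    have "\<exists>S. \<forall>n. (P n (S n) \<and> (n = 0 \<longrightarrow> S n = (0, \<lambda>x. x))) \<and> Q n (S n) (S (Suc n))"
      using start step by (intro dependent_nat_choice) auto
    then show ?thesis using that by blast
  qed
  define a g where "a n = fst (S n)" and "g n = snd (S n)" for n
  have "convergent a"
    using S(2) \<delta> by (intro convergent_geometric_increments[of _ \<delta>]) (auto simp: Q_def a_def)
  then obtain c where c: "a \<longlonglongrightarrow> c" by (auto simp: convergent_def)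
  have g_conv: "\<exists>y. (\<lambda>n. g n x) \<longlonglongrightarrow> y" if "x \<in> X" for x
  proof -
    have "norm (g (Suc n) x - g n x) \<le> (1/2) ^ n" for n
    proof -
      have "norm (g (Suc n) x - g n x) \<le> (1/2) ^ Suc n"
        using S(2)[of n] that by (simp add: Q_def g_def)
      also have "\<dots> \<le> (1/2) ^ n" by simp
      finally show ?thesis .
    qed
    then show ?thesis
      using convergent_geometric_increments[of "\<lambda>n. g n x" "1/2"] by (auto simp: convergent_def)
  qed
  define h where "h x = lim (\<lambda>n. g n x)" for x
  have h: "(\<lambda>n. g n x) \<longlonglongrightarrow> h x" if "x \<in> X" for x
    using g_conv[OF that] by (simp add: h_def convergent_LIMSEQ_iff[symmetric] convergent_def)
  show thesis
  proof
    fix x assume x: "x \<in> X"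
    have "(\<lambda>n. \<delta> ^ n) \<longlonglongrightarrow> 0"
      using \<delta> by (simp add: LIMSEQ_realpow_zero)
    then have "(\<lambda>n. \<delta> ^ n *\<^sub>R g n x + g n x * a n) \<longlonglongrightarrow> 0 *\<^sub>R h x + h x * c"
      by (intro tendsto_add tendsto_scaleR tendsto_mult h[OF x] c)
    moreover have "x = \<delta> ^ n *\<^sub>R g n x + g n x * a n" for n
      using S(1)[of n] x unfolding P_def a_def g_def by blast
    then have "(\<lambda>n. \<delta> ^ n *\<^sub>R g n x + g n x * a n) = (\<lambda>n. x)"
      by (intro ext) (rule sym)
    ultimately show "x = h x * c"
      by (simp add: LIMSEQ_const_iff)
    have "norm (g n x - x) \<le> 1 - (1/2) ^ n" for n
    proof (induction n)
      case 0
      then show ?case by (simp add: g_def S0)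
    next
      case (Suc n)
      have "norm (g (Suc n) x - g n x) \<le> (1/2) ^ Suc n"
        using S(2)[of n] x by (simp add: Q_def g_def)
      then show ?case
        using Suc norm_triangle_ineq[of "g (Suc n) x - g n x" "g n x - x"] by simp
    qed
    moreover have "1 - (1/2) ^ n \<le> (1::real)" for n by simp
    ultimately have "norm (g n x - x) \<le> 1" for n
      by (rule order_trans)
    then show "norm (h x - x) \<le> 1"
      by (intro tendsto_upperbound[OF tendsto_norm[OF tendsto_diff[OF h[OF x] tendsto_const]]]) auto
  qed
qed

section \<open>Automatic boundedness\<close>

text \<open>
  Boundedness of \<open>f\<close> makes the tail of the sequence uniformly small, and the finitely many remaining
  terms are handled one by one.
\<close>

lemma uniform_limit_null_sequence_mult_approx_identity:
  fixes f :: "'i \<Rightarrow> 'a::{real_normed_algebra, banach}" and b :: "nat \<Rightarrow> 'a"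
  assumes bai: "bounded_approx_identity f F" and b: "b \<longlonglongrightarrow> 0"
  shows "uniform_limit (range b) (\<lambda>i x. x * f i) (\<lambda>x. x) F"
proof (rule uniform_limitI)
  fix \<epsilon> :: real assume \<epsilon>: "0 < \<epsilon>"
  obtain M where M: "M > 0" "\<And>i. norm (f i) \<le> M"
    using bai unfolding bounded_approx_identity_def bounded_pos by auto
  have "eventually (\<lambda>n. norm (b n) < \<epsilon> / (M + 1)) sequentially"
    using tendstoD[OF b, of "\<epsilon> / (M + 1)"] \<epsilon> M by simp
  then obtain N where N: "\<And>n. n \<ge> N \<Longrightarrow> norm (b n) < \<epsilon> / (M + 1)"
    by (auto simp: eventually_sequentially)
  have tail: "dist (b n * f i) (b n) < \<epsilon>" if "n \<ge> N" for n i
  proof -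
    have "dist (b n * f i) (b n) \<le> norm (b n * f i) + norm (b n)"
      by (simp add: dist_norm norm_triangle_ineq4)
    also have "\<dots> \<le> norm (b n) * norm (f i) + norm (b n)"
      by (simp add: norm_mult_ineq)
    also have "\<dots> \<le> norm (b n) * M + norm (b n)"
      using M by (intro add_mono mult_left_mono) auto
    also have "\<dots> = norm (b n) * (M + 1)" by (simp add: algebra_simps)
    also have "\<dots> < \<epsilon>"
      using N[OF that] M by (simp add: pos_less_divide_eq)
    finally show ?thesis .
  qed
  have "eventually (\<lambda>i. dist (b n * f i) (b n) < \<epsilon>) F" for n
    using bai \<epsilon> by (auto simp: bounded_approx_identity_def intro: tendstoD)
  then have "eventually (\<lambda>i. \<forall>n\<in>{..<N}. dist (b n * f i) (b n) < \<epsilon>) F"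
    by (intro eventually_ball_finite) auto
  then show "eventually (\<lambda>i. \<forall>x\<in>range b. dist (x * f i) x < \<epsilon>) F"
  proof eventually_elim
    case (elim i)
    then show ?case
      using tail by (auto simp: not_less[symmetric])
  qed
qed

text \<open>
  The functions \<open>p s\<close> are absolutely homogeneous over the reals; in the application they are
  \<open>a \<mapsto> norm (T a z)\<close> for a linear \<open>T\<close>, indexed by the vectors \<open>z\<close> and weighted by their norm. If the
  family were unbounded, there would be a null sequence \<open>b\<close> along which it is unbounded. Writing
  \<open>b n = g (b n) * c\<close> with bounded left factors contradicts the bound on multiples of \<open>c\<close>.
\<close>

lemma uniform_bound_from_right_multiples:
  fixes f :: "'i \<Rightarrow> 'a::{real_normed_algebra, banach}" and p :: "'s \<Rightarrow> 'a \<Rightarrow> real"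
  assumes bai: "bounded_approx_identity f F"
    and hom: "\<And>s r a. s \<in> A \<Longrightarrow> p s (r *\<^sub>R a) = \<bar>r\<bar> * p s a"
    and w: "\<And>s. s \<in> A \<Longrightarrow> 0 \<le> w s"
    and mult: "\<And>c. \<exists>K. \<forall>s\<in>A. \<forall>b. p s (b * c) \<le> K * norm b * w s"
  shows "\<exists>K. \<forall>s\<in>A. \<forall>a. p s a \<le> K * norm a * w s"
proof (rule ccontr)
  assume unbounded: "\<not> ?thesis"
  have "\<exists>s a. s \<in> A \<and> p s a > real n ^ 2 * norm a * w s" for n
    using unbounded by (meson linorder_not_le)
  then obtain s a where sA: "\<And>n. s n \<in> A"
    and large: "\<And>n. p (s n) (a n) > real n ^ 2 * norm (a n) * w (s n)"
    by metis
  have p_0: "p t 0 = 0" if "t \<in> A" for t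
    using hom[OF that, of 0 0] by simp
  have a_pos: "norm (a n) > 0" for n
    using large[of n] p_0[OF sA[of n]] by auto
  \<comment> \<open>The square in the choice of \<open>a\<close> leaves room to shrink: after rescaling to norm \<open>1 / n\<close>, the
    value at \<open>b n\<close> still exceeds \<open>n\<close> times the weight.\<close>
  define b where "b n = (1 / (real n * norm (a n))) *\<^sub>R a n" for n
  have norm_b: "norm (b n) = 1 / real n" for n
    using a_pos[of n] by (simp add: b_def)
  have p_b: "p (s n) (b n) > real n * w (s n)" if "n > 0" for n
  proof -
    have "p (s n) (b n) = p (s n) (a n) / (real n * norm (a n))"
      using a_pos[of n] that by (simp add: b_def hom[OF sA])
    moreover have "real n * w (s n) * (real n * norm (a n)) < p (s n) (a n)"
      using large[of n] by (simp add: power2_eq_square mult_ac)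
    ultimately show ?thesis
      using a_pos[of n] that by (simp add: less_divide_eq)
  qed
  have "(\<lambda>n. norm (b n)) \<longlonglongrightarrow> 0"
    unfolding norm_b by (rule lim_1_over_n)
  then have b: "b \<longlonglongrightarrow> 0"
    by (rule tendsto_norm_zero_cancel)
  have "bounded (range b)"
    using b convergent_imp_bounded by blast
  then obtain c g where c: "\<And>x. x \<in> range b \<Longrightarrow> x = g x * c"
    and g: "\<And>x. x \<in> range b \<Longrightarrow> norm (g x - x) \<le> 1"
    by (rule Cohen_factorization_uniform[OF bai _
        uniform_limit_null_sequence_mult_approx_identity[OF bai b]]) blast
  obtain K where K: "\<And>t b. t \<in> A \<Longrightarrow> p t (b * c) \<le> K * norm b * w t"
    using mult[of c] by blast
  obtain n where n: "2 * \<bar>K\<bar> < real n"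
    using reals_Archimedean2 by blast
  then have "n > 0" by (cases n) auto
  have "norm (g (b n)) \<le> 1 + norm (b n)"
    using g[of "b n"] norm_triangle_sub[of "g (b n)" "b n"] by simp
  also have "\<dots> \<le> 2"
    using \<open>n > 0\<close> by (simp add: norm_b)
  finally have "K * norm (g (b n)) \<le> \<bar>K\<bar> * 2"
    by (intro mult_mono) auto
  then have "K * norm (g (b n)) * w (s n) \<le> \<bar>K\<bar> * 2 * w (s n)"
    by (rule mult_right_mono[OF _ w[OF sA]])
  with K[OF sA, of n "g (b n)"] have "p (s n) (g (b n) * c) \<le> \<bar>K\<bar> * 2 * w (s n)"
    by (rule order_trans)
  moreover have "g (b n) * c = b n"
    by (rule c[symmetric]) (rule rangeI)
  ultimately have "p (s n) (b n) \<le> \<bar>K\<bar> * 2 * w (s n)"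
    by (simp only:)
  also have "\<dots> \<le> real n * w (s n)"
    using n w[OF sA] by (intro mult_right_mono) auto
  finally show False
    using p_b[OF \<open>n > 0\<close>] by simp
qed

section \<open>Left module homomorphisms into a dual bimodule\<close>

text \<open>
  Tychonoff's theorem for nets. A subnet is represented by a finer proper filter on the same index
  type: the neighbourhoods of a cluster point, pulled back along \<open>\<psi>\<close>, are adjoined to \<open>F\<close>.
\<close>

lemma pointwise_convergent_subnet:
  fixes \<psi> :: "'i \<Rightarrow> 'z \<Rightarrow> 'b::topological_space"
  assumes "F \<noteq> bot" and compact_B: "\<And>z. compact (B z)" and \<psi>: "\<And>i z. \<psi> i z \<in> B z"
  obtains \<phi> H where "H \<noteq> bot" "H \<le> F" "\<And>z. \<phi> z \<in> B z" "\<And>z. ((\<lambda>i. \<psi> i z) \<longlongrightarrow> \<phi> z) H"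
proof -
  have "compactin (product_topology (\<lambda>_. euclidean) UNIV) (PiE UNIV B)"
    using compact_B by (simp add: compactin_PiE)
  then have "compact (PiE UNIV B)"
    by (simp add: euclidean_product_topology)
  moreover have "filtermap \<psi> F \<noteq> bot" "eventually (\<lambda>\<phi>. \<phi> \<in> PiE UNIV B) (filtermap \<psi> F)"
    using assms by (auto simp: filtermap_bot_iff eventually_filtermap PiE_UNIV_domain)
  ultimately obtain \<phi> where \<phi>: "\<phi> \<in> PiE UNIV B" "inf (nhds \<phi>) (filtermap \<psi> F) \<noteq> bot"
    unfolding compact_filter by blast
  define H where "H = inf (filtercomap \<psi> (nhds \<phi>)) F"
  have "H \<noteq> bot"
  proof
    assume "H = bot"
    then have "eventually (\<lambda>_. False) H" by simp
    then obtain P Q where "eventually P (filtercomap \<psi> (nhds \<phi>))" and Q: "eventually Q F"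
      and PQ: "\<And>i. P i \<Longrightarrow> Q i \<Longrightarrow> False"
      unfolding H_def eventually_inf by auto
    then obtain R where R: "eventually R (nhds \<phi>)" "\<And>i. R (\<psi> i) \<Longrightarrow> P i"
      unfolding eventually_filtercomap by auto
    have "eventually (\<lambda>\<xi>. \<not> R \<xi>) (filtermap \<psi> F)"
      unfolding eventually_filtermap using Q by (rule eventually_mono) (use R(2) PQ in blast)
    with R(1) have "eventually (\<lambda>_. False) (inf (nhds \<phi>) (filtermap \<psi> F))"
      unfolding eventually_inf by blast
    with \<phi>(2) show False by (simp add: eventually_False)
  qed
  moreover have "H \<le> F" by (simp add: H_def)
  moreover have "((\<lambda>i. \<psi> i z) \<longlongrightarrow> \<phi> z) H" for z
  proof -
    have "filterlim \<psi> (nhds \<phi>) H"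
      unfolding H_def filterlim_def
      by (rule order_trans[OF filtermap_mono[OF inf_le1] filtermap_filtercomap])
    moreover have "continuous_on UNIV (\<lambda>\<xi> :: 'z \<Rightarrow> 'b. \<xi> z)"
      by (rule continuous_on_product_coordinates)
    ultimately show ?thesis
      using continuous_on_tendsto_compose[of UNIV "\<lambda>\<xi>. \<xi> z" \<psi> \<phi> H] by simp
  qed
  ultimately show thesis
    using that \<phi>(1) by (auto simp: PiE_iff)
qed

lemma dual_bimodule_simps:
  "vcarrier (dual_bimodule Z) = bounded_functionals Z"
  "z \<in> vcarrier Z \<Longrightarrow> vadd (dual_bimodule Z) \<psi> \<xi> z = \<psi> z + \<xi> z"
  "z \<in> vcarrier Z \<Longrightarrow> vscale (dual_bimodule Z) c \<psi> z = c * \<psi> z"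
  "z \<in> vcarrier Z \<Longrightarrow> vdiff (dual_bimodule Z) \<psi> \<xi> z = \<psi> z - \<xi> z"
  "z \<in> vcarrier Z \<Longrightarrow> lact (dual_bimodule Z) a \<psi> z = \<psi> (ract Z z a)"
  "z \<in> vcarrier Z \<Longrightarrow> ract (dual_bimodule Z) \<psi> a z = \<psi> (lact Z a z)"
  by (simp_all add: dual_bimodule_def vdiff_def)

lemma vdiff_dual_bimodule_extensional:
  "vdiff (dual_bimodule Z) \<psi> \<xi> \<in> extensional (vcarrier Z)"
  by (simp add: dual_bimodule_def vdiff_def)

lemma bounded_functionalsI:
  assumes "\<psi> \<in> extensional (vcarrier Z)"
    and "\<And>x y. x \<in> vcarrier Z \<Longrightarrow> y \<in> vcarrier Z \<Longrightarrow> \<psi> (vadd Z x y) = \<psi> x + \<psi> y"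
    and "\<And>c x. x \<in> vcarrier Z \<Longrightarrow> \<psi> (vscale Z c x) = c * \<psi> x"
    and "\<And>x. x \<in> vcarrier Z \<Longrightarrow> norm (\<psi> x) \<le> K * vnorm Z x"
  shows "\<psi> \<in> bounded_functionals Z"
  using assms unfolding bounded_functionals_def by blast

lemma bounded_functionalsD:
  assumes "\<psi> \<in> bounded_functionals Z"
  shows "\<psi> \<in> extensional (vcarrier Z)"
    and "\<And>x y. x \<in> vcarrier Z \<Longrightarrow> y \<in> vcarrier Z \<Longrightarrow> \<psi> (vadd Z x y) = \<psi> x + \<psi> y"
    and "\<And>c x. x \<in> vcarrier Z \<Longrightarrow> \<psi> (vscale Z c x) = c * \<psi> x"
  using assms by (auto simp: bounded_functionals_def)

lemma (in normed_vspace) bounded_functionals_nonneg_bound: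
  assumes "\<psi> \<in> bounded_functionals Z"
  obtains K where "0 \<le> K" "\<And>x. x \<in> vcarrier Z \<Longrightarrow> norm (\<psi> x) \<le> K * vnorm Z x"
proof -
  obtain K where K: "\<And>x. x \<in> vcarrier Z \<Longrightarrow> norm (\<psi> x) \<le> K * vnorm Z x"
    using assms unfolding bounded_functionals_def by blast
  have "norm (\<psi> x) \<le> \<bar>K\<bar> * vnorm Z x" if x: "x \<in> vcarrier Z" for x
    using K[OF x] mult_right_mono[OF abs_ge_self[of K] norm_nonneg[OF x]] by (rule order_trans)
  then show thesis
    using that abs_ge_zero by blast
qed

lemma (in normed_vspace) bounded_functionals_add:
  assumes \<psi>: "\<psi> \<in> bounded_functionals Z" and \<xi>: "\<xi> \<in> bounded_functionals Z"
  shows "(\<lambda>z\<in>vcarrier Z. \<psi> z + \<xi> z) \<in> bounded_functionals Z"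
proof -
  obtain K where K: "\<And>x. x \<in> vcarrier Z \<Longrightarrow> norm (\<psi> x) \<le> K * vnorm Z x"
    using bounded_functionals_nonneg_bound[OF \<psi>] by blast
  obtain L where L: "\<And>x. x \<in> vcarrier Z \<Longrightarrow> norm (\<xi> x) \<le> L * vnorm Z x"
    using bounded_functionals_nonneg_bound[OF \<xi>] by blast
  show ?thesis
  proof (rule bounded_functionalsI)
    show "norm ((\<lambda>z\<in>vcarrier Z. \<psi> z + \<xi> z) x) \<le> (K + L) * vnorm Z x" if x: "x \<in> vcarrier Z" for x
      using norm_triangle_ineq[of "\<psi> x" "\<xi> x"] K[OF x] L[OF x] x
      by (simp add: distrib_right)
  qed (simp_all add: add_closed scale_closed algebra_simps
      bounded_functionalsD(2,3)[OF \<psi>] bounded_functionalsD(2,3)[OF \<xi>])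
qed

text \<open>
  The assumption \<open>mult\<close> reads \<open>T (a b) = a \<cdot> T b\<close> for the dual action. For fixed \<open>c\<close> the map
  \<open>b \<mapsto> T (b c) = b \<cdot> T c\<close> is bounded, since the functional \<open>T c\<close> and the right action on \<open>Z\<close> are.
\<close>

lemma left_module_map_into_dual_bounded:
  fixes Z :: "('a::{real_normed_algebra, banach}, 'k::{real_normed_field, heine_borel}, 'z, 'm) bimod_scheme"
    and f :: "'i \<Rightarrow> 'a"
  assumes alg: "banach_algebra scl" and Z: "banach_bimodule scl UNIV Z"
    and bai: "bounded_approx_identity f F"
    and T: "\<And>a. T a \<in> bounded_functionals Z"
    and scale: "\<And>c a z. z \<in> vcarrier Z \<Longrightarrow> T (scl c a) z = c * T a z"
    and mult: "\<And>a b z. z \<in> vcarrier Z \<Longrightarrow> T (a * b) z = T b (ract Z z a)"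
  shows "\<exists>K. \<forall>z\<in>vcarrier Z. \<forall>a. norm (T a z) \<le> K * norm a * vnorm Z z"
proof (rule uniform_bound_from_right_multiples[OF bai, where p = "\<lambda>z a. norm (T a z)"])
  interpret banach_algebra scl by (rule alg)
  interpret banach_bimodule scl UNIV Z by (rule Z)
  show "norm (T (r *\<^sub>R a) z) = \<bar>r\<bar> * norm (T a z)" if "z \<in> vcarrier Z" for r a z
    using scale[OF that, of "of_real r" a] by (simp add: scale_of_real norm_mult)
  show "0 \<le> vnorm Z z" if "z \<in> vcarrier Z" for z
    by (rule norm_nonneg[OF that])
  show "\<exists>K. \<forall>z\<in>vcarrier Z. \<forall>b. norm (T (b * c) z) \<le> K * norm b * vnorm Z z" for c
  proof -
    obtain L where L: "L \<ge> 0" "\<And>z. z \<in> vcarrier Z \<Longrightarrow> norm (T c z) \<le> L * vnorm Z z"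
      using bounded_functionals_nonneg_bound[OF T] by blast
    obtain R where R: "\<And>z b. z \<in> vcarrier Z \<Longrightarrow> vnorm Z (ract Z z b) \<le> R * norm b * vnorm Z z"
      using ract_bounded by auto
    have "norm (T (b * c) z) \<le> L * R * norm b * vnorm Z z" if z: "z \<in> vcarrier Z" for z b
    proof -
      have zb: "ract Z z b \<in> vcarrier Z" by (simp add: ract_closed z)
      have "norm (T (b * c) z) \<le> L * vnorm Z (ract Z z b)"
        using L(2)[OF zb] by (simp add: mult[OF z])
      also have "\<dots> \<le> L * (R * norm b * vnorm Z z)"
        by (intro mult_left_mono R z L)
      finally show ?thesis by (simp add: mult_ac)
    qed
    then show ?thesis by blast
  qed
qed

text \<open>
  The functional \<open>\<phi>\<close> is a weak* cluster point of \<open>T (f i)\<close>. The action by \<open>a\<close> is weak* continuous, so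
  \<open>a \<cdot> \<phi>\<close> is a limit of \<open>a \<cdot> T (f i) = T (a f i)\<close>, which tends to \<open>T a\<close> by boundedness of \<open>T\<close>. The
  last conclusion keeps the only other property of the cluster point that matters: it annihilates
  every vector that is annihilated by the whole net.
\<close>

lemma left_module_map_into_dual_eq_orbit_map:
  fixes Z :: "('a::{real_normed_algebra, banach}, 'k::{real_normed_field, heine_borel}, 'z, 'm) bimod_scheme"
    and f :: "'i \<Rightarrow> 'a"
  assumes alg: "banach_algebra scl" and Z: "banach_bimodule scl UNIV Z"
    and bai: "bounded_approx_identity f F"
    and T: "\<And>a. T a \<in> bounded_functionals Z"
    and add: "\<And>a b z. z \<in> vcarrier Z \<Longrightarrow> T (a + b) z = T a z + T b z"
    and scale: "\<And>c a z. z \<in> vcarrier Z \<Longrightarrow> T (scl c a) z = c * T a z"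
    and mult: "\<And>a b z. z \<in> vcarrier Z \<Longrightarrow> T (a * b) z = T b (ract Z z a)"
  obtains \<phi> where "\<phi> \<in> bounded_functionals Z"
    "\<And>a z. z \<in> vcarrier Z \<Longrightarrow> T a z = \<phi> (ract Z z a)"
    "\<And>z. z \<in> vcarrier Z \<Longrightarrow> (\<And>a. T a z = 0) \<Longrightarrow> \<phi> z = 0"
proof -
  interpret banach_algebra scl by (rule alg)
  interpret banach_bimodule scl UNIV Z by (rule Z)
  obtain K where K: "\<And>z a. z \<in> vcarrier Z \<Longrightarrow> norm (T a z) \<le> K * norm a * vnorm Z z"
    using left_module_map_into_dual_bounded[OF alg Z bai T scale mult] by blast
  obtain M where M: "\<And>i. norm (f i) \<le> M"
    using bai unfolding bounded_approx_identity_def bounded_iff by auto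
  have F: "F \<noteq> bot" using bai by (simp add: bounded_approx_identity_def)
  \<comment> \<open>Off the carrier, the singleton forces the cluster point to be extensional.\<close>
  define B where "B z = (if z \<in> vcarrier Z then cball 0 (\<bar>K\<bar> * M * vnorm Z z) else {undefined :: 'k})" for z
  have "compact (B z)" for z by (simp add: B_def)
  moreover have "T (f i) z \<in> B z" for i z
  proof (cases "z \<in> vcarrier Z")
    case True
    have "norm (T (f i) z) \<le> K * norm (f i) * vnorm Z z" by (rule K[OF True])
    also have "\<dots> \<le> \<bar>K\<bar> * M * vnorm Z z"
      using M[of i] norm_nonneg[OF True] by (intro mult_right_mono mult_mono) auto
    finally show ?thesis using True by (simp add: B_def)
  next
    case False
    then show ?thesis
      using bounded_functionalsD(1)[OF T, of "f i"] by (simp add: B_def extensional_def)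
  qed
  ultimately obtain \<phi> H where H: "H \<noteq> bot" "H \<le> F" and \<phi>_B: "\<And>z. \<phi> z \<in> B z"
    and lim: "\<And>z. ((\<lambda>i. T (f i) z) \<longlongrightarrow> \<phi> z) H"
    by (rule pointwise_convergent_subnet[OF F, where \<psi> = "\<lambda>i. T (f i)" and B = B]) blast
  have unique: "l = \<phi> z" if "((\<lambda>i. T (f i) z) \<longlongrightarrow> l) H" for l z
    using tendsto_unique[OF H(1) that lim] .
  show thesis
  proof
    show "\<phi> \<in> bounded_functionals Z"
    proof (rule bounded_functionalsI)
      show "\<phi> \<in> extensional (vcarrier Z)"
      proof -
        have "\<phi> z = undefined" if "z \<notin> vcarrier Z" for z
          using \<phi>_B[of z] that by (simp add: B_def)
        then show ?thesis by (simp add: extensional_def)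
      qed
      show "\<phi> (vadd Z x y) = \<phi> x + \<phi> y" if "x \<in> vcarrier Z" "y \<in> vcarrier Z" for x y
        using tendsto_add[OF lim lim, of x y] that
        by (intro unique[symmetric]) (simp add: bounded_functionalsD(2)[OF T])
      show "\<phi> (vscale Z c x) = c * \<phi> x" if "x \<in> vcarrier Z" for c x
        using tendsto_mult_left[OF lim, of c x] that
        by (intro unique[symmetric]) (simp add: bounded_functionalsD(3)[OF T])
      show "norm (\<phi> x) \<le> \<bar>K\<bar> * M * vnorm Z x" if "x \<in> vcarrier Z" for x
        using \<phi>_B[of x] that by (simp add: B_def)
    qed
  next
    fix a z assume z: "z \<in> vcarrier Z"
    have "((\<lambda>i. a * f i - a) \<longlongrightarrow> 0) F"
      using bai by (simp add: bounded_approx_identity_def LIM_zero)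
    then have "((\<lambda>i. K * norm (a * f i - a) * vnorm Z z) \<longlongrightarrow> K * norm (0::'a) * vnorm Z z) F"
      by (intro tendsto_intros)
    then have "((\<lambda>i. K * norm (a * f i - a) * vnorm Z z) \<longlongrightarrow> 0) F" by simp
    then have "((\<lambda>i. T (a * f i - a) z) \<longlongrightarrow> 0) F"
      by (rule Lim_null_comparison[rotated]) (simp add: K z)
    then have "((\<lambda>i. T a z + T (a * f i - a) z) \<longlongrightarrow> T a z + 0) F"
      by (intro tendsto_add tendsto_const)
    then have "((\<lambda>i. T (a * f i) z) \<longlongrightarrow> T a z) F"
      by (simp add: add[OF z, symmetric])
    then have "((\<lambda>i. T (f i) (ract Z z a)) \<longlongrightarrow> T a z) H"
      using tendsto_mono[OF H(2)] by (simp add: mult[OF z])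
    then show "T a z = \<phi> (ract Z z a)"
      by (rule unique)
  next
    fix z assume "z \<in> vcarrier Z" "\<And>a. T a z = 0"
    then show "\<phi> z = 0"
      by (intro unique[symmetric]) simp
  qed
qed

section \<open>Amenability passes from the ideal to the algebra\<close>

theorem theorem5p4:
  fixes scl :: "'k::{real_normed_field, heine_borel} \<Rightarrow> 'a::{real_normed_algebra, banach} \<Rightarrow> 'a"
    and I :: "'a set"
    and f :: "'i \<Rightarrow> 'a" and F :: "'i filter"
    and e :: "'j \<Rightarrow> 'a" and G :: "'j filter"
  assumes "banach_algebra scl"
    and "bounded_approx_identity f F"
    and "closed_left_ideal scl I"
    and "amenable TYPE('z) scl I"
    and "range e \<subseteq> I"
    and "bounded_left_approx_identity e G"
  shows "amenable TYPE('z) scl UNIV"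
  unfolding amenable_def
proof (intro allI impI)
  fix Z :: "('a, 'k, 'z) bimod" and D
  assume Z: "banach_bimodule scl UNIV Z"
    and D: "continuous_derivation scl UNIV (dual_bimodule Z) D"
  interpret banach_bimodule scl UNIV Z by (rule Z)
  have ideal: "\<And>a x. x \<in> I \<Longrightarrow> a * x \<in> I"
    using assms(3) by (simp add: closed_left_ideal_def)
  have D_carrier: "\<And>a. D a \<in> bounded_functionals Z"
    and D_add: "\<And>a b. D (a + b) = vadd (dual_bimodule Z) (D a) (D b)"
    and D_scale: "\<And>c a. D (scl c a) = vscale (dual_bimodule Z) c (D a)"
    and D_mult: "\<And>a b. D (a * b) =
      vadd (dual_bimodule Z) (lact (dual_bimodule Z) a (D b)) (ract (dual_bimodule Z) (D a) b)"
    using D by (auto simp: continuous_derivation_def dual_bimodule_simps(1))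
  have "\<exists>K. \<forall>a\<in>I. \<forall>z\<in>vcarrier Z. vnorm Z (lact Z a z) \<le> K * norm a * vnorm Z z"
    and "\<exists>K. \<forall>a\<in>I. \<forall>z\<in>vcarrier Z. vnorm Z (ract Z z a) \<le> K * norm a * vnorm Z z"
    using lact_bounded ract_bounded by (meson UNIV_I)+
  then have "banach_bimodule scl I Z"
    by unfold_locales (auto intro: lact_closed ract_closed lact_add_left lact_scale_left
        lact_add_right lact_scale_right ract_add_left ract_scale_left ract_add_right
        ract_scale_right lact_mult ract_mult lact_ract)
  moreover have "continuous_derivation scl I (dual_bimodule Z) D"
    using D by (auto simp: continuous_derivation_def continuous_map_from_subtopology)
  ultimately have "inner_derivation I (dual_bimodule Z) D"
    using assms(4) by (simp add: amenable_def)
  then obtain \<xi> where \<xi>: "\<xi> \<in> bounded_functionals Z"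
    and D_I: "\<And>x. x \<in> I \<Longrightarrow> D x =
      vdiff (dual_bimodule Z) (lact (dual_bimodule Z) x \<xi>) (ract (dual_bimodule Z) \<xi> x)"
    by (auto simp: inner_derivation_def dual_bimodule_simps(1))
  define T where "T a = (\<lambda>z\<in>vcarrier Z. D a z - (\<xi> (ract Z z a) - \<xi> (lact Z a z)))" for a
  have closed: "lact Z a z \<in> vcarrier Z" "ract Z z a \<in> vcarrier Z" if "z \<in> vcarrier Z" for a z
    using that by (auto intro: lact_closed ract_closed)
  have T: "T a z = D a z - (\<xi> (ract Z z a) - \<xi> (lact Z a z))" if "z \<in> vcarrier Z" for a z
    using that by (simp add: T_def)
  have T_carrier: "T a \<in> bounded_functionals Z" for a
  proof -
    obtain K1 where K1: "\<And>x. x \<in> vcarrier Z \<Longrightarrow> norm (D a x) \<le> K1 * vnorm Z x"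
      using bounded_functionals_nonneg_bound[OF D_carrier] by blast
    obtain K2 where K2: "K2 \<ge> 0" "\<And>x. x \<in> vcarrier Z \<Longrightarrow> norm (\<xi> x) \<le> K2 * vnorm Z x"
      using bounded_functionals_nonneg_bound[OF \<xi>] by blast
    obtain L where L: "\<And>z. z \<in> vcarrier Z \<Longrightarrow> vnorm Z (lact Z a z) \<le> L * norm a * vnorm Z z"
      using lact_bounded by auto
    obtain R where R: "\<And>z. z \<in> vcarrier Z \<Longrightarrow> vnorm Z (ract Z z a) \<le> R * norm a * vnorm Z z"
      using ract_bounded by auto
    show ?thesis
    proof (rule bounded_functionalsI)
      fix z assume z: "z \<in> vcarrier Z"
      have "norm (\<xi> (ract Z z a)) \<le> K2 * (R * norm a * vnorm Z z)"
        by (rule order_trans[OF K2(2)[OF closed(2)[OF z]] mult_left_mono[OF R[OF z] K2(1)]])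
      moreover have "norm (\<xi> (lact Z a z)) \<le> K2 * (L * norm a * vnorm Z z)"
        by (rule order_trans[OF K2(2)[OF closed(1)[OF z]] mult_left_mono[OF L[OF z] K2(1)]])
      moreover have "norm (D a z) \<le> K1 * vnorm Z z"
        by (rule K1[OF z])
      moreover have "norm (T a z) \<le> norm (D a z) + (norm (\<xi> (ract Z z a)) + norm (\<xi> (lact Z a z)))"
        unfolding T[OF z]
        by (rule order_trans[OF norm_triangle_ineq4 add_left_mono[OF norm_triangle_ineq4]])
      ultimately show "norm (T a z) \<le> (K1 + K2 * R * norm a + K2 * L * norm a) * vnorm Z z"
        by (simp add: algebra_simps)
    qed (simp_all add: T_def add_closed scale_closed closed algebra_simps
        lact_add_right lact_scale_right ract_add_left ract_scale_left
        bounded_functionalsD(2,3)[OF D_carrier] bounded_functionalsD(2,3)[OF \<xi>])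
  qed
  have T_add: "T (a + b) z = T a z + T b z" if "z \<in> vcarrier Z" for a b z
    using that by (simp add: T D_add dual_bimodule_simps closed lact_add_left ract_add_right
        bounded_functionalsD(2)[OF \<xi>])
  have T_scale: "T (scl c a) z = c * T a z" if "z \<in> vcarrier Z" for c a z
    using that by (simp add: T D_scale dual_bimodule_simps closed lact_scale_left ract_scale_right
        bounded_functionalsD(3)[OF \<xi>] algebra_simps)
  \<comment> \<open>\<open>T\<close> is again a derivation, as inner derivations are.\<close>
  have T_mult: "T (a * b) z = T b (ract Z z a) + T a (lact Z b z)" if "z \<in> vcarrier Z" for a b z
    using that by (simp add: T D_mult dual_bimodule_simps closed lact_mult ract_mult lact_ract)
  have T_I: "T x z = 0" if "x \<in> I" "z \<in> vcarrier Z" for x z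
    using that by (simp add: T D_I dual_bimodule_simps)
  \<comment> \<open>Both \<open>x\<close> and \<open>a * x\<close> lie in the left ideal, so two of the three terms of \<open>T_mult\<close> vanish.\<close>
  have T_IZ: "T a (lact Z x z) = 0" if "x \<in> I" "z \<in> vcarrier Z" for a x z
    using T_mult[OF that(2), of a x] T_I that ideal closed by simp
  \<comment> \<open>Elements \<open>e j * b\<close> act as \<open>e j\<close> on \<open>lact Z b z\<close>, hence \<open>T a\<close> cannot see them; subtracting one
    from \<open>b\<close> leaves an action of arbitrarily small norm.\<close>
  have T_AZ: "T a (lact Z b z) = 0" if z: "z \<in> vcarrier Z" for a b z
  proof -
    obtain K where K: "K \<ge> 0" "\<And>x. x \<in> vcarrier Z \<Longrightarrow> norm (T a x) \<le> K * vnorm Z x"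
      using bounded_functionals_nonneg_bound[OF T_carrier] by blast
    obtain L where L: "\<And>a. vnorm Z (lact Z a z) \<le> L * norm a * vnorm Z z"
      using lact_bounded z by auto
    have split: "T a (lact Z b z) = T a (lact Z (b - e j * b) z)" for j
    proof -
      have "lact Z b z = vadd Z (lact Z (b - e j * b) z) (lact Z (e j) (lact Z b z))"
        using lact_add_left[of "b - e j * b" "e j * b" z] lact_mult[of "e j" b z] z by simp
      moreover have "e j \<in> I" using assms(5) by auto
      ultimately show ?thesis
        using bounded_functionalsD(2)[OF T_carrier] T_IZ closed z by (metis add.right_neutral)
    qed
    have bound: "norm (T a (lact Z b z)) \<le> K * (L * norm (b - e j * b) * vnorm Z z)" for j
    proof -
      have "norm (T a (lact Z b z)) \<le> K * vnorm Z (lact Z (b - e j * b) z)"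
        unfolding split[of j] by (rule K(2)[OF closed(1)[OF z]])
      also have "\<dots> \<le> K * (L * norm (b - e j * b) * vnorm Z z)"
        by (intro mult_left_mono L K)
      finally show ?thesis .
    qed
    have G: "G \<noteq> bot" "((\<lambda>j. e j * b) \<longlongrightarrow> b) G"
      using assms(6) by (auto simp: bounded_left_approx_identity_def)
    have "((\<lambda>j. K * (L * norm (b - e j * b) * vnorm Z z)) \<longlongrightarrow> K * (L * norm (b - b) * vnorm Z z)) G"
      by (intro tendsto_intros G)
    then have "norm (T a (lact Z b z)) \<le> K * (L * norm (b - b) * vnorm Z z)"
      by (rule tendsto_lowerbound) (use bound G in auto)
    then show ?thesis by simp
  qed
  obtain \<phi> where \<phi>: "\<phi> \<in> bounded_functionals Z"
    and T_\<phi>: "\<And>a z. z \<in> vcarrier Z \<Longrightarrow> T a z = \<phi> (ract Z z a)"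
    and \<phi>_0: "\<And>z. z \<in> vcarrier Z \<Longrightarrow> (\<And>a. T a z = 0) \<Longrightarrow> \<phi> z = 0"
  proof (rule left_module_map_into_dual_eq_orbit_map[OF assms(1) Z assms(2) T_carrier T_add T_scale])
    show "T (a * b) z = T b (ract Z z a)" if "z \<in> vcarrier Z" for a b z
      using T_mult T_AZ that by simp
  qed blast+
  let ?x = "\<lambda>z\<in>vcarrier Z. \<xi> z + \<phi> z"
  have "D a = vdiff (dual_bimodule Z) (lact (dual_bimodule Z) a ?x) (ract (dual_bimodule Z) ?x a)" for a
  proof (rule extensionalityI)
    show "D a \<in> extensional (vcarrier Z)"
      by (rule bounded_functionalsD(1)[OF D_carrier])
    fix z assume z: "z \<in> vcarrier Z"
    have "\<phi> (lact Z a z) = 0"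
      by (rule \<phi>_0) (simp_all add: closed z T_AZ)
    then show "D a z =
        vdiff (dual_bimodule Z) (lact (dual_bimodule Z) a ?x) (ract (dual_bimodule Z) ?x a) z"
      using T[OF z, of a] T_\<phi>[OF z, of a] z
      by (simp add: dual_bimodule_simps closed algebra_simps)
  qed (rule vdiff_dual_bimodule_extensional)
  moreover have "?x \<in> bounded_functionals Z"
    by (rule bounded_functionals_add[OF \<xi> \<phi>])
  ultimately show "inner_derivation UNIV (dual_bimodule Z) D"
    by (auto simp: inner_derivation_def dual_bimodule_simps(1))
qed

end
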